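(* Let $X$ be a locally path connected space and $x_0\in X$. The following statements are equivalent. (1) $X$ is unbased semilocally simply connected. (2) $\pi_1^{\mathrm{Span}}(X,x_0)$ is discrete. (3) $\pi_1^{\mathrm{pSpan}}(X,x_0)$ is discrete. Moreover, each of these statements implies that $\pi_1^{\mathrm{Span}}(X,x_0)=\pi_1^{\mathrm{pSpan}}(X,x_0)$ (i.e. the two topologies on $\pi_1(X,x_0)$ coincide) and that $\widetilde\pi_1^{sp}(X,x_0)=\pi_1^{sp}(X,x_0)$.
   Context: $X$ is unbased semilocally simply connected if every $x\in X$ has an open neighbourhood $U$ such that every loop in $U$ (based at any point of $U$) is null-homotopic in $X$. For an open cover $\mathcal U$ of $X$, the Spanier subgroup $\pi(\mathcal U,x_0)$ is the normal subgroup of $\pi_1(X,x_0)$ generated by all classes $[\alpha*\beta*\alpha^{-1}]$, where $\alpha$ is a path in $X$ starting at $x_0$ and $\beta$ is a loop based at $\alpha(1)$ lying in some $U\in\mathcal U$. The space $\pi_1^{\mathrm{Span}}(X,x_0)$ is $\pi_1(X,x_0)$ with the topology having as a basis all left cosets $g\,\pi(\mathcal U,x_0)$, where $g\in\pi_1(X,x_0)$ and $\mathcal U$ is an open cover of $X$. The Spanier group $\pi_1^{sp}(X,x_0)$ is the intersection of all Spanier subgroups $\pi(\mathcal U,x_0)$. Let $P(X,x_0)$ be the set of paths in $X$ starting at $x_0$. A path open cover (of the path component of $X$ containing $x_0$) is a family $\mathcal V=\{V_\alpha\mid\alpha\in P(X,x_0)\}$ of open subsets of $X$ with $\alpha(1)\in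 V_\alpha$. The path Spanier subgroup $\widetilde\pi(\mathcal V,x_0)$ is the subgroup of $\pi_1(X,x_0)$ consisting of all classes with a representative of the form $\prod_{j=1}^n\alpha_j*\beta_j*\alpha_j^{-1}$, where $\alpha_j\in P(X,x_0)$ and $\beta_j$ is a loop based at $\alpha_j(1)$ lying in $V_{\alpha_j}$. The space $\pi_1^{\mathrm{pSpan}}(X,x_0)$ is $\pi_1(X,x_0)$ with the topology having as a basis all left cosets $g\,\widetilde\pi(\mathcal V,x_0)$, where $g\in\pi_1(X,x_0)$ and $\mathcal V$ is a path open cover. The group $\widetilde\pi_1^{sp}(X,x_0)$ is the intersection of all path Spanier subgroups $\widetilde\pi(\mathcal V,x_0)$.
   Formalization: The implications from (2) or (3) back to (1) are stated for path connected X only, as they fail for an isolated point x0 plus a disjoint Hawaiian earring; (1)⇒(2), (2)⇔(3) and the "moreover" part hold for every locally path connected X. *)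

theory Defs
  imports "HOL-Analysis.Analysis" "HOL-Algebra.Coset"
begin

text \<open>A space is a set \<open>X\<close> in a type of class \<open>topological_space\<close>, with the subspace topology
  \<open>top_of_set X\<close>; the case \<open>X = UNIV\<close> gives an arbitrary topological space.\<close>

definition loops_at :: "'a::topological_space set \<Rightarrow> 'a \<Rightarrow> (real \<Rightarrow> 'a) set" where
  "loops_at X x = {p. path p \<and> path_image p \<subseteq> X \<and> pathstart p = x \<and> pathfinish p = x}"

definition unbased_slsc :: "'a::topological_space set \<Rightarrow> bool" where
  "unbased_slsc X \<longleftrightarrow>
     (\<forall>x\<in>X. \<exists>U. openin (top_of_set X) U \<and> x \<in> U \<and>
        (\<forall>y\<in>U. \<forall>b\<in>loops_at U y. homotopic_paths X b (\<lambda>_. y)))"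

subsection \<open>The fundamental group\<close>

definition path_class :: "'a::topological_space set \<Rightarrow> (real \<Rightarrow> 'a) \<Rightarrow> (real \<Rightarrow> 'a) set" where
  "path_class X p = {q. homotopic_paths X p q}"

definition pi1 :: "'a::topological_space set \<Rightarrow> 'a \<Rightarrow> (real \<Rightarrow> 'a) set monoid" where
  "pi1 X x0 =
     \<lparr>carrier = path_class X ` loops_at X x0,
      mult = (\<lambda>A B. {r. \<exists>p\<in>A. \<exists>q\<in>B. homotopic_paths X (p +++ q) r}),
      one = path_class X (\<lambda>_. x0)\<rparr>"

text \<open>A path is a function on the unit interval only, so paths that serve as indices of a family
  are taken to be \<open>undefined\<close> outside it; otherwise one path would carry several indices.\<close>

definition paths_from :: "'a::topological_space set \<Rightarrow> 'a \<Rightarrow> (real \<Rightarrow> 'a) set" where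
  "paths_from X x0 =
     {a \<in> extensional {0..1}. path a \<and> path_image a \<subseteq> X \<and> pathstart a = x0}"

subsection \<open>Topologies on a group with a basis of left cosets\<close>

definition coset_topology :: "('g, 'm) monoid_scheme \<Rightarrow> 'g set set \<Rightarrow> 'g topology" where
  "coset_topology G \<H> =
     topology (arbitrary union_of (\<lambda>B. \<exists>g\<in>carrier G. \<exists>H\<in>\<H>. B = g <#\<^bsub>G\<^esub> H))"

text \<open>Since \<open>topology\<close> is unspecified on predicates that are not topologies, we record that a
  family of subgroups directed downwards does give a basis.\<close>

lemma openin_coset_topology:
  assumes "group G" and sub: "\<And>H. H \<in> \<H> \<Longrightarrow> subgroup H G"
    and dir: "\<And>H K. \<lbrakk>H \<in> \<H>; K \<in> \<H>\<rbrakk> \<Longrightarrow> \<exists>L\<in>\<H>. L \<subseteq> H \<inter> K"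
  shows "openin (coset_topology G \<H>) =
           arbitrary union_of (\<lambda>B. \<exists>g\<in>carrier G. \<exists>H\<in>\<H>. B = g <#\<^bsub>G\<^esub> H)"
proof -
  interpret group G by fact
  let ?P = "\<lambda>B. \<exists>g\<in>carrier G. \<exists>H\<in>\<H>. B = g <#\<^bsub>G\<^esub> H"
  have "(arbitrary union_of ?P) (S \<inter> T)" if ST: "?P S" "?P T" for S T
  proof -
    obtain g H where g: "g \<in> carrier G" "H \<in> \<H>" "S = g <#\<^bsub>G\<^esub> H" using ST by blast
    obtain k K where k: "k \<in> carrier G" "K \<in> \<H>" "T = k <#\<^bsub>G\<^esub> K" using ST by blast
    obtain L where L: "L \<in> \<H>" "L \<subseteq> H" "L \<subseteq> K" using dir[OF g(2) k(2)] by blast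
    have *: "x \<in> carrier G \<and> x \<in> x <#\<^bsub>G\<^esub> L \<and> x <#\<^bsub>G\<^esub> L \<subseteq> S \<inter> T" if x: "x \<in> S \<inter> T" for x
    proof -
      have xc: "x \<in> carrier G"
        using x g sub[OF g(2)] by (auto simp: l_coset_def dest: subgroup.mem_carrier)
      have "x <#\<^bsub>G\<^esub> H = S" "x <#\<^bsub>G\<^esub> K = T"
        using l_repr_independence[OF _ g(1) sub[OF g(2)], of x]
              l_repr_independence[OF _ k(1) sub[OF k(2)], of x] x g(3) k(3) by auto
      moreover have "x \<in> x <#\<^bsub>G\<^esub> L"
        using xc subgroup.one_closed[OF sub[OF L(1)]] by (force simp: l_coset_def)
      ultimately show ?thesis using xc L by (auto simp: l_coset_def)
    qed
    have "S \<inter> T = \<Union> ((\<lambda>x. x <#\<^bsub>G\<^esub> L) ` (S \<inter> T))" using * by blast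
    moreover have "(\<lambda>x. x <#\<^bsub>G\<^esub> L) ` (S \<inter> T) \<subseteq> Collect ?P" using * L(1) by blast
    ultimately show ?thesis unfolding union_of_def arbitrary_def by blast
  qed
  then have "istopology (arbitrary union_of ?P)" unfolding istopology_base_eq by blast
  then show ?thesis unfolding coset_topology_def by (rule topology_inverse')
qed

subsection \<open>Spanier subgroups\<close>

definition open_cover :: "'a::topological_space set \<Rightarrow> 'a set set \<Rightarrow> bool" where
  "open_cover X \<U> \<longleftrightarrow> (\<forall>U\<in>\<U>. openin (top_of_set X) U) \<and> \<Union>\<U> = X"

definition spanier_subgroup ::
  "'a::topological_space set \<Rightarrow> 'a set set \<Rightarrow> 'a \<Rightarrow> (real \<Rightarrow> 'a) set set" where
  "spanier_subgroup X \<U> x0 =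
     (\<lambda>N. N \<lhd> pi1 X x0) hull
       {path_class X (a +++ b +++ reversepath a) | a b U.
          a \<in> paths_from X x0 \<and> U \<in> \<U> \<and> b \<in> loops_at U (pathfinish a)}"

definition spanier_topology :: "'a::topological_space set \<Rightarrow> 'a \<Rightarrow> (real \<Rightarrow> 'a) set topology" where
  "spanier_topology X x0 =
     coset_topology (pi1 X x0) {spanier_subgroup X \<U> x0 | \<U>. open_cover X \<U>}"

definition spanier_group :: "'a::topological_space set \<Rightarrow> 'a \<Rightarrow> (real \<Rightarrow> 'a) set set" where
  "spanier_group X x0 = \<Inter>{spanier_subgroup X \<U> x0 | \<U>. open_cover X \<U>}"

subsection \<open>Path Spanier subgroups\<close>

definition path_open_cover ::
  "'a::topological_space set \<Rightarrow> 'a \<Rightarrow> ((real \<Rightarrow> 'a) \<Rightarrow> 'a set) \<Rightarrow> bool" where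
  "path_open_cover X x0 V \<longleftrightarrow>
     (\<forall>a\<in>paths_from X x0. openin (top_of_set X) (V a) \<and> pathfinish a \<in> V a)"

text \<open>The final constant loop in the concatenation below is harmless up to homotopy.\<close>

definition path_spanier_subgroup ::
  "'a::topological_space set \<Rightarrow> ((real \<Rightarrow> 'a) \<Rightarrow> 'a set) \<Rightarrow> 'a \<Rightarrow> (real \<Rightarrow> 'a) set set" where
  "path_spanier_subgroup X V x0 =
     {path_class X (foldr (+++) ps (\<lambda>_. x0)) | ps.
        \<forall>p\<in>set ps. \<exists>a\<in>paths_from X x0. \<exists>b\<in>loops_at (V a) (pathfinish a).
          p = a +++ b +++ reversepath a}"

definition path_spanier_topology ::
  "'a::topological_space set \<Rightarrow> 'a \<Rightarrow> (real \<Rightarrow> 'a) set topology" where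
  "path_spanier_topology X x0 =
     coset_topology (pi1 X x0) {path_spanier_subgroup X V x0 | V. path_open_cover X x0 V}"

definition path_spanier_group :: "'a::topological_space set \<Rightarrow> 'a \<Rightarrow> (real \<Rightarrow> 'a) set set" where
  "path_spanier_group X x0 = \<Inter>{path_spanier_subgroup X V x0 | V. path_open_cover X x0 V}"

end

theory Submission
  imports Defs "HOL-Algebra.Generated_Groups"
begin

text \<open>
  Call the class of a loop \<open>a +++ b +++ reversepath a\<close> a lasso. Both kinds of Spanier subgroup are
  generated by lassos, as a normal subgroup or as a mere subgroup, and they differ only in which
  open sets may contain the loop \<open>b\<close>. Three observations reduce the theorem to a comparison of
  covers.

  First, a topology whose basis consists of the left cosets of a directed family of subgroups is
  discrete exactly when the trivial subgroup belongs to the family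
  (\<open>coset_topology_discrete_iff\<close>): an open set inside \<open>{\<one>}\<close> has to be a coset of the
  trivial subgroup. Second, a subgroup generated by lassos, normally or not, is trivial exactly
  when all its lassos are. Third, a lasso is trivial exactly when its loop \<open>b\<close> is null-homotopic,
  because homotopy classes of paths cancel on either side (\<open>homotopic_paths_lasso_iff\<close>).

  Hence the Spanier topology is discrete if and only if some open cover has the property that loops
  in its members, based at points of the path component of \<open>x0\<close>, are null-homotopic in \<open>X\<close>. In a
  path connected space this says that the space is unbased semilocally simply connected, and in any
  space it follows from that condition. Likewise for the path Spanier topology, with a path open
  cover \<open>V\<close> and only those loops in \<open>V a\<close> that are based at the endpoint of \<open>a\<close>. An open cover
  yields a path open cover by choosing a member around each endpoint. Conversely, local path
  connectedness allows each \<open>V a\<close> to be shrunk to a path connected neighbourhood of the endpoint of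
  \<open>a\<close>. Inside it, a loop with any other base point can be conjugated to one based at the endpoint.
  These neighbourhoods, together with the complement of the path component, form an open cover
  (\<open>path_open_cover_imp_open_cover\<close>).

  If any of the conditions holds, both topologies are discrete, and both intersections are trivial
  because the trivial group occurs among the subgroups that are intersected.
\<close>

section \<open>Homotopy of paths in an arbitrary space\<close>

text \<open>The unit interval is convex, so paths in it with common endpoints are homotopic, and the
  homotopy is carried along by \<open>p\<close>. This gives the groupoid laws without any linear structure on
  the space of \<open>p\<close>, so with constant paths in the place of \<open>linepath\<close>.\<close>

lemma homotopic_paths_compose_unit_interval:
  fixes p :: "real \<Rightarrow> 'a::topological_space"
  assumes "path p" "path_image p \<subseteq> X"
    and "path f" "path g" "path_image f \<subseteq> {0..1}" "path_image g \<subseteq> {0..1}"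
    and "pathstart f = pathstart g" "pathfinish f = pathfinish g"
  shows "homotopic_paths X (p \<circ> f) (p \<circ> g)"
proof (rule homotopic_paths_continuous_image)
  show "homotopic_paths {0..1} f g"
  proof (rule homotopic_paths_linear)
    fix t :: real assume "t \<in> {0..1}"
    then have "f t \<in> {0..1}" "g t \<in> {0..1}"
      using assms(5,6) unfolding path_image_def by blast+
    then show "closed_segment (f t) (g t) \<subseteq> {0..1}"
      by (intro closed_segment_subset) auto
  qed (use assms in auto)
  show "continuous_on {0..1} p" "p \<in> {0..1} \<rightarrow> X"
    using assms(1,2) by (auto simp: path_def path_image_def)
qed

lemma path_const [simp]: "path (\<lambda>_. x)"
  by (simp add: path_def)

lemma path_image_const [simp]: "path_image (\<lambda>_. x) = {x}"
  by (auto simp: path_image_def)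

lemma path_ends_const [simp]: "pathstart (\<lambda>_. x) = x" "pathfinish (\<lambda>_. x) = x"
  by (simp_all add: pathstart_def pathfinish_def)

lemma path_id_unit: "path (id :: real \<Rightarrow> real)" "path_image (id :: real \<Rightarrow> real) = {0..1}"
    "pathstart (id :: real \<Rightarrow> real) = 0" "pathfinish (id :: real \<Rightarrow> real) = 1"
  by (simp_all add: path_def path_image_def pathstart_def pathfinish_def)

context
  fixes p :: "real \<Rightarrow> 'a::topological_space" and X
  assumes p: "path p" "path_image p \<subseteq> X"
begin

lemma homotopic_paths_const_right: "homotopic_paths X (p +++ (\<lambda>_. pathfinish p)) p"
proof -
  have "homotopic_paths X (p \<circ> (id +++ (\<lambda>_. 1))) (p \<circ> id)"
    using p by (intro homotopic_paths_compose_unit_interval subset_path_image_join)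
      (simp_all add: path_id_unit)
  then show ?thesis by (simp add: path_compose_join) (simp add: comp_def pathfinish_def)
qed

lemma homotopic_paths_const_left: "homotopic_paths X ((\<lambda>_. pathstart p) +++ p) p"
proof -
  have "homotopic_paths X (p \<circ> ((\<lambda>_. 0) +++ id)) (p \<circ> id)"
    using p by (intro homotopic_paths_compose_unit_interval subset_path_image_join)
      (simp_all add: path_id_unit)
  then show ?thesis by (simp add: path_compose_join) (simp add: comp_def pathstart_def)
qed

lemma homotopic_paths_reversepath_right:
  "homotopic_paths X (p +++ reversepath p) (\<lambda>_. pathstart p)"
proof -
  have "homotopic_paths X (p \<circ> (id +++ reversepath id)) (p \<circ> (\<lambda>_. 0))"
    using p by (intro homotopic_paths_compose_unit_interval subset_path_image_join)
      (simp_all add: path_id_unit)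
  then show ?thesis
    by (simp add: path_compose_join path_compose_reversepath) (simp add: comp_def pathstart_def)
qed

end

lemma homotopic_paths_reversepath_left:
  assumes "path p" "path_image p \<subseteq> X"
  shows "homotopic_paths X (reversepath p +++ p) (\<lambda>_. pathfinish p)"
  using homotopic_paths_reversepath_right[of "reversepath p" X] assms by simp

lemma homotopic_paths_cancel_left:
  assumes h: "homotopic_paths X (a +++ b) (a +++ c)"
    and a: "path a" "path_image a \<subseteq> X"
    and b: "path b" "path_image b \<subseteq> X" "pathfinish a = pathstart b"
    and c: "path c" "path_image c \<subseteq> X" "pathfinish a = pathstart c"
  shows "homotopic_paths X b c"
proof -
  have cancel: "homotopic_paths X (reversepath a +++ (a +++ d)) d"
    if d: "path d" "path_image d \<subseteq> X" "pathfinish a = pathstart d" for d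
  proof -
    have "homotopic_paths X (reversepath a +++ (a +++ d)) ((reversepath a +++ a) +++ d)"
      using a d by (intro homotopic_paths_assoc) auto
    also have "homotopic_paths X \<dots> ((\<lambda>_. pathfinish a) +++ d)"
      using a d by (intro homotopic_paths_join homotopic_paths_reversepath_left) auto
    also have "homotopic_paths X \<dots> d"
      using homotopic_paths_const_left[OF d(1,2)] d(3) by simp
    finally show ?thesis .
  qed
  have "homotopic_paths X b (reversepath a +++ (a +++ b))"
    using cancel[OF b] by (rule homotopic_paths_sym)
  also have "homotopic_paths X \<dots> (reversepath a +++ (a +++ c))"
    using a b(3) h by (intro homotopic_paths_join h) auto
  also have "homotopic_paths X \<dots> c"
    by (rule cancel[OF c])
  finally show ?thesis .
qed

lemma homotopic_paths_cancel_right: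
  assumes h: "homotopic_paths X (b +++ a) (c +++ a)"
    and a: "path a" "path_image a \<subseteq> X"
    and b: "path b" "path_image b \<subseteq> X" "pathfinish b = pathstart a"
    and c: "path c" "path_image c \<subseteq> X" "pathfinish c = pathstart a"
  shows "homotopic_paths X b c"
proof -
  have "homotopic_paths X (reversepath (b +++ a)) (reversepath (c +++ a))"
    using h by (simp only: homotopic_paths_reversepath)
  then have "homotopic_paths X (reversepath a +++ reversepath b) (reversepath a +++ reversepath c)"
    using b c by (simp add: reversepath_joinpaths)
  then have "homotopic_paths X (reversepath b) (reversepath c)"
    by (rule homotopic_paths_cancel_left) (use a b c in auto)
  then show ?thesis by (simp only: homotopic_paths_reversepath)
qed

lemma loops_atD:
  assumes "b \<in> loops_at U x"
  shows "path b" "path_image b \<subseteq> U" "pathstart b = x" "pathfinish b = x"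
  using assms by (auto simp: loops_at_def)

lemma base_point_in: "b \<in> loops_at U x \<Longrightarrow> x \<in> U"
  using loops_atD[of b U x] pathfinish_in_path_image[of b] by blast

lemma loops_at_mono: "U \<subseteq> W \<Longrightarrow> loops_at U x \<subseteq> loops_at W x"
  by (auto simp: loops_at_def)

lemma reversepath_in_loops_at: "b \<in> loops_at U x \<Longrightarrow> reversepath b \<in> loops_at U x"
  by (simp add: loops_at_def)

lemma join_in_loops_at: "\<lbrakk>b \<in> loops_at U x; c \<in> loops_at U x\<rbrakk> \<Longrightarrow> b +++ c \<in> loops_at U x"
  by (simp add: loops_at_def subset_path_image_join)

lemma const_in_loops_at: "x \<in> U \<Longrightarrow> (\<lambda>_. x) \<in> loops_at U x"
  by (simp add: loops_at_def)

lemma conjugate_in_loops_at: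
  assumes "path a" "path_image a \<subseteq> X" "b \<in> loops_at X (pathfinish a)"
  shows "a +++ b +++ reversepath a \<in> loops_at X (pathstart a)"
  using assms by (simp add: loops_at_def subset_path_image_join)

text \<open>Compare the conjugate with \<open>a +++ reversepath a\<close> and cancel \<open>a\<close> on both sides.\<close>

lemma homotopic_paths_lasso_iff:
  assumes a: "path a" "path_image a \<subseteq> X" and b: "b \<in> loops_at X (pathfinish a)"
  shows "homotopic_paths X (a +++ b +++ reversepath a) (\<lambda>_. pathstart a) \<longleftrightarrow>
         homotopic_paths X b (\<lambda>_. pathfinish a)"
proof
  note b = loops_atD[OF b]
  have e: "pathfinish a \<in> X" using a by (meson pathfinish_in_path_image subsetD)
  have unit: "homotopic_paths X ((\<lambda>_. pathfinish a) +++ reversepath a) (reversepath a)"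
    using homotopic_paths_const_left[of "reversepath a" X] a by simp
  {
    assume "homotopic_paths X b (\<lambda>_. pathfinish a)"
    then have "homotopic_paths X (a +++ b +++ reversepath a)
        (a +++ (\<lambda>_. pathfinish a) +++ reversepath a)"
      using a b by (intro homotopic_paths_join) auto
    also have "homotopic_paths X \<dots> (a +++ reversepath a)"
      using a unit by (intro homotopic_paths_join) auto
    also have "homotopic_paths X \<dots> (\<lambda>_. pathstart a)"
      by (rule homotopic_paths_reversepath_right[OF a])
    finally show "homotopic_paths X (a +++ b +++ reversepath a) (\<lambda>_. pathstart a)" .
  next
    assume "homotopic_paths X (a +++ b +++ reversepath a) (\<lambda>_. pathstart a)"
    also have "homotopic_paths X \<dots> (a +++ reversepath a)"
      by (rule homotopic_paths_sym[OF homotopic_paths_reversepath_right[OF a]])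
    finally have "homotopic_paths X (b +++ reversepath a) (reversepath a)"
      by (rule homotopic_paths_cancel_left) (use a b in \<open>simp_all add: subset_path_image_join\<close>)
    also have "homotopic_paths X \<dots> ((\<lambda>_. pathfinish a) +++ reversepath a)"
      by (rule homotopic_paths_sym[OF unit])
    finally show "homotopic_paths X b (\<lambda>_. pathfinish a)"
      by (rule homotopic_paths_cancel_right) (use a b e in simp_all)
  }
qed

lemma paths_fromD:
  assumes "a \<in> paths_from X x0"
  shows "path a" "path_image a \<subseteq> X" "pathstart a = x0" "pathfinish a \<in> X"
proof -
  show a: "path a" "path_image a \<subseteq> X" "pathstart a = x0"
    using assms by (simp_all add: paths_from_def)
  show "pathfinish a \<in> X"
    using a(2) pathfinish_in_path_image by blast
qed

lemma path_component_imp_paths_from: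
  assumes "path_component X x0 y"
  obtains a where "a \<in> paths_from X x0" "pathfinish a = y"
proof -
  obtain p where p: "path p" "path_image p \<subseteq> X" "pathstart p = x0" "pathfinish p = y"
    using assms by (auto simp: path_component_def)
  have "path (restrict p {0..1})"
    using p(1) unfolding path_def by (rule continuous_on_eq) simp
  then have "restrict p {0..1} \<in> paths_from X x0"
    using p by (auto simp: paths_from_def path_image_def pathstart_def)
  moreover have "pathfinish (restrict p {0..1}) = y"
    using p by (simp add: pathfinish_def)
  ultimately show thesis by (rule that)
qed

lemma paths_from_imp_path_component:
  "a \<in> paths_from X x0 \<Longrightarrow> path_component X x0 (pathfinish a)"
  unfolding path_component_def paths_from_def by blast

section \<open>The fundamental group\<close>

lemma path_class_eq_iff:
  assumes "path p" "path_image p \<subseteq> X"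
  shows "path_class X p = path_class X q \<longleftrightarrow> homotopic_paths X p q"
proof
  assume "path_class X p = path_class X q"
  moreover have "p \<in> path_class X p" using assms by (simp add: path_class_def)
  ultimately show "homotopic_paths X p q"
    by (simp add: path_class_def homotopic_paths_sym)
next
  assume "homotopic_paths X p q"
  then show "path_class X p = path_class X q"
    unfolding path_class_def by (blast intro: homotopic_paths_trans homotopic_paths_sym)
qed

lemma path_class_in_carrier: "p \<in> loops_at X x0 \<Longrightarrow> path_class X p \<in> carrier (pi1 X x0)"
  by (simp add: pi1_def)

lemma one_pi1: "\<one>\<^bsub>pi1 X x0\<^esub> = path_class X (\<lambda>_. x0)"
  by (simp add: pi1_def)

lemma mult_pi1:
  assumes p: "p \<in> loops_at X x0" and q: "q \<in> loops_at X x0"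
  shows "path_class X p \<otimes>\<^bsub>pi1 X x0\<^esub> path_class X q = path_class X (p +++ q)"
proof -
  note p = loops_atD[OF p] and q = loops_atD[OF q]
  have "homotopic_paths X (p +++ q) r"
    if "homotopic_paths X p p'" "homotopic_paths X q q'" "homotopic_paths X (p' +++ q') r"
    for p' q' r
  proof -
    have "homotopic_paths X (p +++ q) (p' +++ q')"
      using that p q by (intro homotopic_paths_join) auto
    then show ?thesis using that(3) by (rule homotopic_paths_trans)
  qed
  moreover have "homotopic_paths X p p" "homotopic_paths X q q" using p q by auto
  ultimately show ?thesis
    unfolding pi1_def path_class_def monoid.simps by blast
qed

lemma group_pi1:
  assumes "x0 \<in> X"
  shows "group (pi1 X x0)"
proof (rule groupI)
  fix A B C
  assume A: "A \<in> carrier (pi1 X x0)" and B: "B \<in> carrier (pi1 X x0)"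
    and C: "C \<in> carrier (pi1 X x0)"
  obtain p q r where pqr: "p \<in> loops_at X x0" "q \<in> loops_at X x0" "r \<in> loops_at X x0"
    and ABC: "A = path_class X p" "B = path_class X q" "C = path_class X r"
    using A B C by (auto simp: pi1_def)
  note loops = loops_atD[OF pqr(1)] loops_atD[OF pqr(2)] loops_atD[OF pqr(3)]
  have "homotopic_paths X (p +++ q +++ r) ((p +++ q) +++ r)"
    using loops by (intro homotopic_paths_assoc) auto
  then have "path_class X (p +++ q +++ r) = path_class X ((p +++ q) +++ r)"
    using loops by (subst path_class_eq_iff) (simp_all add: subset_path_image_join)
  then show "A \<otimes>\<^bsub>pi1 X x0\<^esub> B \<otimes>\<^bsub>pi1 X x0\<^esub> C = A \<otimes>\<^bsub>pi1 X x0\<^esub> (B \<otimes>\<^bsub>pi1 X x0\<^esub> C)"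
    using pqr by (simp add: ABC mult_pi1 join_in_loops_at)
next
  fix A B assume "A \<in> carrier (pi1 X x0)" "B \<in> carrier (pi1 X x0)"
  then obtain p q where "p \<in> loops_at X x0" "q \<in> loops_at X x0"
      "A = path_class X p" "B = path_class X q"
    by (auto simp: pi1_def)
  then show "A \<otimes>\<^bsub>pi1 X x0\<^esub> B \<in> carrier (pi1 X x0)"
    by (simp add: mult_pi1 path_class_in_carrier join_in_loops_at)
next
  show "\<one>\<^bsub>pi1 X x0\<^esub> \<in> carrier (pi1 X x0)"
    by (simp add: one_pi1 path_class_in_carrier const_in_loops_at assms)
next
  fix A assume "A \<in> carrier (pi1 X x0)"
  then obtain p where p: "p \<in> loops_at X x0" "A = path_class X p"
    by (auto simp: pi1_def)
  note pD = loops_atD[OF p(1)]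
  have "path_class X ((\<lambda>_. x0) +++ p) = path_class X p"
    using homotopic_paths_const_left[OF pD(1,2)] pD assms
    by (subst path_class_eq_iff) (simp_all add: subset_path_image_join)
  then show "\<one>\<^bsub>pi1 X x0\<^esub> \<otimes>\<^bsub>pi1 X x0\<^esub> A = A"
    using p assms by (simp add: one_pi1 mult_pi1 const_in_loops_at)
  have "path_class X (reversepath p +++ p) = path_class X (\<lambda>_. x0)"
    using homotopic_paths_reversepath_left[OF pD(1,2)] pD
    by (subst path_class_eq_iff) (simp_all add: subset_path_image_join)
  then show "\<exists>B\<in>carrier (pi1 X x0). B \<otimes>\<^bsub>pi1 X x0\<^esub> A = \<one>\<^bsub>pi1 X x0\<^esub>"
    using p by (intro bexI[of _ "path_class X (reversepath p)"])
      (simp_all add: one_pi1 mult_pi1 path_class_in_carrier reversepath_in_loops_at)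
qed

lemma inv_pi1:
  assumes "x0 \<in> X" and p: "p \<in> loops_at X x0"
  shows "inv\<^bsub>pi1 X x0\<^esub> path_class X p = path_class X (reversepath p)"
proof -
  interpret group "pi1 X x0" by (rule group_pi1) fact
  note pD = loops_atD[OF p]
  have "path_class X (reversepath p +++ p) = path_class X (\<lambda>_. x0)"
    using homotopic_paths_reversepath_left[OF pD(1,2)] pD
    by (subst path_class_eq_iff) (simp_all add: subset_path_image_join)
  then show ?thesis
    using p by (intro inv_equality)
      (simp_all add: one_pi1 mult_pi1 path_class_in_carrier reversepath_in_loops_at)
qed

section \<open>Discrete coset topologies\<close>

text \<open>An open \<open>{\<one>}\<close> is a union of basic cosets, so one of the cosets is \<open>{\<one>}\<close> itself; as left
  translations are injective, the subgroup in question has one element.\<close>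

lemma coset_topology_discrete_iff:
  fixes G (structure)
  assumes G: "group G" and sub: "\<And>H. H \<in> \<H> \<Longrightarrow> subgroup H G"
    and dir: "\<And>H K. \<lbrakk>H \<in> \<H>; K \<in> \<H>\<rbrakk> \<Longrightarrow> \<exists>L\<in>\<H>. L \<subseteq> H \<inter> K"
  shows "coset_topology G \<H> = discrete_topology (carrier G) \<longleftrightarrow> {\<one>\<^bsub>G\<^esub>} \<in> \<H>"
proof -
  interpret group G by fact
  let ?P = "\<lambda>B. \<exists>g\<in>carrier G. \<exists>H\<in>\<H>. B = g <#\<^bsub>G\<^esub> H"
  have open_iff: "openin (coset_topology G \<H>) = arbitrary union_of ?P"
    using assms by (rule openin_coset_topology)
  show ?thesis
  proof
    assume "coset_topology G \<H> = discrete_topology (carrier G)"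
    then have "(arbitrary union_of ?P) {\<one>}"
      using open_iff by (metis empty_subsetI insert_subset one_closed openin_discrete_topology)
    then obtain \<B> where \<B>: "\<B> \<subseteq> Collect ?P" "\<Union>\<B> = {\<one>}"
      unfolding union_of_def arbitrary_def by auto
    then obtain B where "B \<in> \<B>" "\<one> \<in> B" by blast
    then obtain g H where gH: "g \<in> carrier G" "H \<in> \<H>" "g <# H \<subseteq> {\<one>}"
      using \<B> by blast
    have "h = \<one>" if "h \<in> H" for h
    proof -
      have "\<one> \<in> H" "h \<in> carrier G"
        using sub[OF gH(2)] that by (auto intro: subgroup.one_closed subgroup.mem_carrier)
      moreover have "g \<otimes> h = \<one>" "g \<otimes> \<one> = \<one>"
        using gH(3) that calculation(1) by (auto simp: l_coset_def)
      ultimately show ?thesis using gH(1) by simp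
    qed
    then have "H = {\<one>}" using subgroup.one_closed[OF sub[OF gH(2)]] by blast
    then show "{\<one>} \<in> \<H>" using gH(2) by simp
  next
    assume triv: "{\<one>} \<in> \<H>"
    have "(arbitrary union_of ?P) S \<longleftrightarrow> S \<subseteq> carrier G" for S
    proof
      assume "(arbitrary union_of ?P) S"
      then obtain \<B> where \<B>: "\<B> \<subseteq> Collect ?P" "\<Union>\<B> = S"
        unfolding union_of_def by auto
      have "B \<subseteq> carrier G" if "B \<in> \<B>" for B
      proof -
        obtain g H where gH: "g \<in> carrier G" "H \<in> \<H>" "B = g <# H" using \<B>(1) \<open>B \<in> \<B>\<close> by blast
        show ?thesis
          unfolding gH(3) by (rule l_coset_subset_G[OF subgroup.subset[OF sub[OF gH(2)]] gH(1)])
      qed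
      then show "S \<subseteq> carrier G" using \<B>(2) by blast
    next
      assume S: "S \<subseteq> carrier G"
      have "?P {g}" if "g \<in> S" for g
        using that S triv by (intro bexI[of _ g] bexI[of _ "{\<one>}"]) (auto simp: l_coset_def)
      then have "(\<lambda>g. {g}) ` S \<subseteq> Collect ?P" by blast
      moreover have "\<Union> ((\<lambda>g. {g}) ` S) = S" by blast
      ultimately show "(arbitrary union_of ?P) S"
        unfolding union_of_def arbitrary_def by blast
    qed
    then show "coset_topology G \<H> = discrete_topology (carrier G)"
      unfolding topology_eq open_iff by simp
  qed
qed

lemma (in group) normal_hull_subgroup:
  assumes "S \<subseteq> carrier G"
  shows "subgroup ((\<lambda>N. N \<lhd> G) hull S) G"
  unfolding hull_def
proof (rule subgroups_Inter)
  have "carrier G \<lhd> G" by (rule normal_invI) (auto intro: subgroup_self)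
  then show "{N. N \<lhd> G \<and> S \<subseteq> N} \<noteq> {}" using assms by blast
qed (auto intro: normal_imp_subgroup)

lemma (in group) normal_hull_trivial_iff:
  "(\<lambda>N. N \<lhd> G) hull S = {\<one>} \<longleftrightarrow> S \<subseteq> {\<one>}"
proof
  show "S \<subseteq> {\<one>}" if "(\<lambda>N. N \<lhd> G) hull S = {\<one>}"
    using hull_subset[of S "\<lambda>N. N \<lhd> G"] that by simp
  assume "S \<subseteq> {\<one>}"
  then have "(\<lambda>N. N \<lhd> G) hull S \<subseteq> {\<one>}"
    by (rule hull_minimal) (rule one_is_normal)
  moreover have "\<one> \<in> (\<lambda>N. N \<lhd> G) hull S"
    unfolding hull_def by (auto dest!: normal_imp_subgroup intro: subgroup.one_closed)
  ultimately show "(\<lambda>N. N \<lhd> G) hull S = {\<one>}" by blast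
qed

lemma (in group) generate_trivial_iff: "generate G S = {\<one>} \<longleftrightarrow> S \<subseteq> {\<one>}"
proof
  show "S \<subseteq> {\<one>}" if "generate G S = {\<one>}"
    using that generate.incl[of _ S G] by blast
  assume "S \<subseteq> {\<one>}"
  then have "generate G S \<subseteq> {\<one>}"
    by (rule generate_subgroup_incl) (rule triv_subgroup)
  then show "generate G S = {\<one>}" using generate.one[of G S] by blast
qed

section \<open>Lassos and the subgroups that they generate\<close>

text \<open>The family of admissible sets may depend on the path \<open>a\<close>. A constant family of sets gives the
  generators of a Spanier subgroup and \<open>\<lambda>a. {V a}\<close> those of a path Spanier subgroup.\<close>

definition lasso_classes ::
  "'a::topological_space set \<Rightarrow> ((real \<Rightarrow> 'a) \<Rightarrow> 'a set set) \<Rightarrow> 'a \<Rightarrow> (real \<Rightarrow> 'a) set set" where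
  "lasso_classes X F x0 = {path_class X (a +++ b +++ reversepath a) | a b U.
     a \<in> paths_from X x0 \<and> U \<in> F a \<and> b \<in> loops_at U (pathfinish a)}"

lemma lasso_in_loops_at:
  assumes "a \<in> paths_from X x0" "b \<in> loops_at U (pathfinish a)" "U \<subseteq> X"
  shows "a +++ b +++ reversepath a \<in> loops_at X x0"
proof -
  have "b \<in> loops_at X (pathfinish a)"
    using assms(2) loops_at_mono[OF assms(3)] by (rule subsetD[rotated])
  then show ?thesis
    using conjugate_in_loops_at[OF paths_fromD(1,2)[OF assms(1)]] paths_fromD(3)[OF assms(1)] by simp
qed

lemma lasso_classes_subset_carrier:
  assumes "\<And>a U. \<lbrakk>a \<in> paths_from X x0; U \<in> F a\<rbrakk> \<Longrightarrow> U \<subseteq> X"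
  shows "lasso_classes X F x0 \<subseteq> carrier (pi1 X x0)"
proof
  fix c assume "c \<in> lasso_classes X F x0"
  then obtain a b U where *: "c = path_class X (a +++ b +++ reversepath a)" "a \<in> paths_from X x0"
      "U \<in> F a" "b \<in> loops_at U (pathfinish a)"
    unfolding lasso_classes_def by blast
  then show "c \<in> carrier (pi1 X x0)"
    using path_class_in_carrier[OF lasso_in_loops_at[OF *(2,4) assms[OF *(2,3)]]] by simp
qed

lemma lasso_classes_mono:
  assumes "\<And>a U. \<lbrakk>a \<in> paths_from X x0; U \<in> F a\<rbrakk> \<Longrightarrow> \<exists>W\<in>F' a. U \<subseteq> W"
  shows "lasso_classes X F x0 \<subseteq> lasso_classes X F' x0"
proof
  fix c assume "c \<in> lasso_classes X F x0"
  then obtain a b U where *: "c = path_class X (a +++ b +++ reversepath a)" "a \<in> paths_from X x0"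
      "U \<in> F a" "b \<in> loops_at U (pathfinish a)"
    unfolding lasso_classes_def by blast
  obtain W where "W \<in> F' a" "U \<subseteq> W" using assms[OF *(2,3)] by blast
  then show "c \<in> lasso_classes X F' x0"
    using *(1,2) subsetD[OF loops_at_mono *(4)] unfolding lasso_classes_def by blast
qed

lemma lasso_classes_trivial_iff:
  assumes "\<And>a U. \<lbrakk>a \<in> paths_from X x0; U \<in> F a\<rbrakk> \<Longrightarrow> U \<subseteq> X"
  shows "lasso_classes X F x0 \<subseteq> {\<one>\<^bsub>pi1 X x0\<^esub>} \<longleftrightarrow>
    (\<forall>a\<in>paths_from X x0. \<forall>U\<in>F a. \<forall>b\<in>loops_at U (pathfinish a).
       homotopic_paths X b (\<lambda>_. pathfinish a))"
proof -
  have "path_class X (a +++ b +++ reversepath a) = \<one>\<^bsub>pi1 X x0\<^esub> \<longleftrightarrow>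
      homotopic_paths X b (\<lambda>_. pathfinish a)"
    if a: "a \<in> paths_from X x0" and U: "U \<in> F a" and b: "b \<in> loops_at U (pathfinish a)" for a b U
  proof -
    note aD = paths_fromD[OF a] and loop = loops_atD[OF lasso_in_loops_at[OF a b assms[OF a U]]]
    have "b \<in> loops_at X (pathfinish a)" using loops_at_mono[OF assms[OF a U]] b by blast
    then show ?thesis
      using homotopic_paths_lasso_iff[OF aD(1,2)]
      by (simp add: one_pi1 aD(3) path_class_eq_iff[OF loop(1,2)])
  qed
  note eq_one = this
  have "lasso_classes X F x0 \<subseteq> {\<one>\<^bsub>pi1 X x0\<^esub>} \<longleftrightarrow>
      (\<forall>a\<in>paths_from X x0. \<forall>U\<in>F a. \<forall>b\<in>loops_at U (pathfinish a).
         path_class X (a +++ b +++ reversepath a) = \<one>\<^bsub>pi1 X x0\<^esub>)"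
    unfolding lasso_classes_def by blast
  also have "\<dots> \<longleftrightarrow> (\<forall>a\<in>paths_from X x0. \<forall>U\<in>F a. \<forall>b\<in>loops_at U (pathfinish a).
       homotopic_paths X b (\<lambda>_. pathfinish a))"
    by (intro ball_cong refl) (rule eq_one)
  finally show ?thesis .
qed

lemma spanier_subgroup_eq_hull:
  "spanier_subgroup X \<U> x0 = (\<lambda>N. N \<lhd> pi1 X x0) hull lasso_classes X (\<lambda>_. \<U>) x0"
  by (simp add: spanier_subgroup_def lasso_classes_def)

lemma open_cover_subset: "\<lbrakk>open_cover X \<U>; U \<in> \<U>\<rbrakk> \<Longrightarrow> U \<subseteq> X"
  by (auto simp: open_cover_def)

lemma path_open_cover_subset: "\<lbrakk>path_open_cover X x0 V; a \<in> paths_from X x0\<rbrakk> \<Longrightarrow> V a \<subseteq> X"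
  by (auto simp: path_open_cover_def dest!: openin_imp_subset)

text \<open>The inverse of a lasso is the lasso around the reversed loop, so products of lassos already
  exhaust the subgroup generated by them.\<close>

lemma path_spanier_subgroup_eq_generate:
  assumes "x0 \<in> X" and V: "path_open_cover X x0 V"
  shows "path_spanier_subgroup X V x0 = generate (pi1 X x0) (lasso_classes X (\<lambda>a. {V a}) x0)"
    (is "_ = generate ?G ?S")
proof -
  interpret group ?G by (rule group_pi1) fact
  define lasso where "lasso p \<longleftrightarrow>
    (\<exists>a\<in>paths_from X x0. \<exists>b\<in>loops_at (V a) (pathfinish a). p = a +++ b +++ reversepath a)" for p
  define word where "word ps = foldr (+++) ps (\<lambda>_. x0)" for ps :: "(real \<Rightarrow> 'a) list"
  have S: "?S = path_class X ` Collect lasso"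
    unfolding lasso_classes_def lasso_def by blast
  have H: "path_spanier_subgroup X V x0 = {path_class X (word ps) | ps. \<forall>p\<in>set ps. lasso p}"
    unfolding path_spanier_subgroup_def lasso_def word_def ..
  have lasso_loop: "p \<in> loops_at X x0" if "lasso p" for p
    using that path_open_cover_subset[OF V] unfolding lasso_def by (auto intro: lasso_in_loops_at)
  have word_loop: "word ps \<in> loops_at X x0" if "\<forall>p\<in>set ps. lasso p" for ps
    using that assms(1)
    by (induction ps) (simp_all add: word_def const_in_loops_at join_in_loops_at lasso_loop)
  have word_Nil: "path_class X (word []) = \<one>\<^bsub>?G\<^esub>"
    by (simp add: word_def one_pi1)
  have word_Cons: "path_class X (word (p # ps)) = path_class X p \<otimes>\<^bsub>?G\<^esub> path_class X (word ps)"
    if "lasso p" "\<forall>p\<in>set ps. lasso p" for p ps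
    using mult_pi1[OF lasso_loop word_loop] that by (simp add: word_def)
  have closed: "path_class X (word ps) \<in> carrier ?G" if "\<forall>p\<in>set ps. lasso p" for ps
    using word_loop[OF that] by (rule path_class_in_carrier)
  have word_append: "path_class X (word (ps @ qs)) =
      path_class X (word ps) \<otimes>\<^bsub>?G\<^esub> path_class X (word qs)"
    if "\<forall>p\<in>set ps. lasso p" "\<forall>p\<in>set qs. lasso p" for ps qs
    using that(1)
  proof (induction ps)
    case Nil
    show ?case using closed[OF that(2)] by (simp add: word_Nil)
  next
    case (Cons p ps)
    have ps: "lasso p" "\<forall>p\<in>set ps. lasso p" "\<forall>p\<in>set (ps @ qs). lasso p"
      using Cons.prems that(2) by auto
    have "path_class X (word ((p # ps) @ qs)) =
        path_class X p \<otimes>\<^bsub>?G\<^esub> (path_class X (word ps) \<otimes>\<^bsub>?G\<^esub> path_class X (word qs))"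
      using word_Cons[OF ps(1,3)] Cons.IH[OF ps(2)] by simp
    also have "\<dots> = path_class X (word (p # ps)) \<otimes>\<^bsub>?G\<^esub> path_class X (word qs)"
      using word_Cons[OF ps(1,2)] closed[OF ps(2)] closed[OF that(2)]
        path_class_in_carrier[OF lasso_loop[OF ps(1)]] by (simp add: m_assoc)
    finally show ?case .
  qed
  have inverse: "\<exists>q. lasso q \<and> inv\<^bsub>?G\<^esub> path_class X p = path_class X q" if p: "lasso p" for p
  proof -
    obtain a b where ab: "a \<in> paths_from X x0" "b \<in> loops_at (V a) (pathfinish a)"
        "p = a +++ b +++ reversepath a"
      using p unfolding lasso_def by blast
    let ?q = "a +++ reversepath b +++ reversepath a"
    note aD = paths_fromD[OF ab(1)] and bD = loops_atD[OF ab(2)]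
    have bX: "path_image b \<subseteq> X" using bD(2) path_open_cover_subset[OF V ab(1)] by blast
    have q: "lasso ?q"
      unfolding lasso_def using ab(1) reversepath_in_loops_at[OF ab(2)] by blast
    have "reversepath p = (a +++ reversepath b) +++ reversepath a"
      using aD bD by (simp add: ab(3) reversepath_joinpaths)
    moreover have "homotopic_paths X ?q ((a +++ reversepath b) +++ reversepath a)"
      using aD bD bX by (intro homotopic_paths_assoc) auto
    ultimately have "path_class X ?q = path_class X (reversepath p)"
      using loops_atD[OF lasso_loop[OF q]] by (simp add: path_class_eq_iff)
    then show ?thesis
      using q inv_pi1[OF assms(1) lasso_loop[OF p]] by metis
  qed
  have single: "path_class X p \<in> path_spanier_subgroup X V x0" if "lasso p" for p
  proof -
    have "path_class X (word [p]) = path_class X p"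
      using word_Cons[of p "[]"] that by (simp add: word_Nil path_class_in_carrier lasso_loop)
    then show ?thesis
      using that unfolding H by (intro CollectI exI[of _ "[p]"]) simp
  qed
  show ?thesis
  proof (intro subset_antisym subsetI)
    fix c assume "c \<in> path_spanier_subgroup X V x0"
    then obtain ps where c: "c = path_class X (word ps)" and ps: "\<forall>p\<in>set ps. lasso p"
      unfolding H by blast
    from ps show "c \<in> generate ?G ?S"
      unfolding c
      by (induction ps) (auto simp: word_Nil word_Cons S intro: generate.intros)
  next
    fix c assume "c \<in> generate ?G ?S"
    then show "c \<in> path_spanier_subgroup X V x0"
    proof (induction rule: generate.induct)
      case one
      show ?case unfolding H using word_Nil by force
    next
      case (incl h)
      then show ?case using single by (auto simp: S)
    next
      case (inv h)
      then obtain p where "lasso p" "h = path_class X p" by (auto simp: S)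
      then show ?case using inverse single by metis
    next
      case (eng h1 h2)
      then obtain ps qs where "h1 = path_class X (word ps)" "h2 = path_class X (word qs)"
        and "\<forall>p\<in>set ps. lasso p" "\<forall>p\<in>set qs. lasso p"
        unfolding H by blast
      then show ?case
        unfolding H using word_append[of ps qs]
        by (intro CollectI exI[of _ "ps @ qs"]) auto
    qed
  qed
qed

section \<open>Discreteness in terms of covers\<close>

lemma subgroup_spanier:
  assumes "x0 \<in> X" "open_cover X \<U>"
  shows "subgroup (spanier_subgroup X \<U> x0) (pi1 X x0)"
  unfolding spanier_subgroup_eq_hull
  using assms by (intro group.normal_hull_subgroup group_pi1 lasso_classes_subset_carrier)
    (auto dest: open_cover_subset)

lemma subgroup_path_spanier:
  assumes "x0 \<in> X" "path_open_cover X x0 V"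
  shows "subgroup (path_spanier_subgroup X V x0) (pi1 X x0)"
  unfolding path_spanier_subgroup_eq_generate[OF assms]
  using assms by (intro group.generate_is_subgroup group_pi1 lasso_classes_subset_carrier)
    (auto dest: path_open_cover_subset)

text \<open>The intersections of members of two covers form a common refinement, and refining a cover
  leaves fewer lassos. This makes the left cosets a basis.\<close>

lemma spanier_subgroups_directed:
  assumes U: "open_cover X \<U>" and W: "open_cover X \<W>"
  shows "\<exists>\<R>. open_cover X \<R> \<and>
    spanier_subgroup X \<R> x0 \<subseteq> spanier_subgroup X \<U> x0 \<inter> spanier_subgroup X \<W> x0"
proof (intro exI[of _ "{S \<inter> T | S T. S \<in> \<U> \<and> T \<in> \<W>}"] conjI Int_greatest)
  let ?\<R> = "{S \<inter> T | S T. S \<in> \<U> \<and> T \<in> \<W>}"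
  show "open_cover X ?\<R>"
    unfolding open_cover_def
  proof (intro conjI subset_antisym subsetI)
    fix x assume "x \<in> X"
    then obtain S T where "S \<in> \<U>" "T \<in> \<W>" "x \<in> S" "x \<in> T"
      using U W unfolding open_cover_def by blast
    then show "x \<in> \<Union>?\<R>" by blast
  qed (use U W in \<open>auto simp: open_cover_def\<close>)
  show "spanier_subgroup X ?\<R> x0 \<subseteq> spanier_subgroup X \<U> x0"
    unfolding spanier_subgroup_eq_hull by (intro hull_mono lasso_classes_mono) blast
  show "spanier_subgroup X ?\<R> x0 \<subseteq> spanier_subgroup X \<W> x0"
    unfolding spanier_subgroup_eq_hull by (intro hull_mono lasso_classes_mono) blast
qed

lemma path_spanier_subgroups_directed:
  assumes "x0 \<in> X" and V: "path_open_cover X x0 V" and W: "path_open_cover X x0 W"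
  shows "\<exists>R. path_open_cover X x0 R \<and>
    path_spanier_subgroup X R x0 \<subseteq> path_spanier_subgroup X V x0 \<inter> path_spanier_subgroup X W x0"
proof -
  have R: "path_open_cover X x0 (\<lambda>a. V a \<inter> W a)"
    using V W by (auto simp: path_open_cover_def)
  interpret group "pi1 X x0" by (rule group_pi1) fact
  have "path_spanier_subgroup X (\<lambda>a. V a \<inter> W a) x0 \<subseteq> path_spanier_subgroup X V' x0"
    if "path_open_cover X x0 V'" "\<And>a. V a \<inter> W a \<subseteq> V' a" for V'
    unfolding path_spanier_subgroup_eq_generate[OF assms(1) R]
      path_spanier_subgroup_eq_generate[OF assms(1) that(1)]
    using that(2) by (intro mono_generate lasso_classes_mono) simp
  from this[OF V] this[OF W] R show ?thesis by (intro exI[of _ "\<lambda>a. V a \<inter> W a"]) simp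
qed

lemma spanier_subgroup_trivial_iff:
  assumes "x0 \<in> X" "open_cover X \<U>"
  shows "spanier_subgroup X \<U> x0 = {\<one>\<^bsub>pi1 X x0\<^esub>} \<longleftrightarrow>
    (\<forall>a\<in>paths_from X x0. \<forall>U\<in>\<U>. \<forall>b\<in>loops_at U (pathfinish a).
       homotopic_paths X b (\<lambda>_. pathfinish a))"
  unfolding spanier_subgroup_eq_hull group.normal_hull_trivial_iff[OF group_pi1[OF assms(1)]]
  by (rule lasso_classes_trivial_iff) (use open_cover_subset[OF assms(2)] in auto)

lemma path_spanier_subgroup_trivial_iff:
  assumes "x0 \<in> X" "path_open_cover X x0 V"
  shows "path_spanier_subgroup X V x0 = {\<one>\<^bsub>pi1 X x0\<^esub>} \<longleftrightarrow>
    (\<forall>a\<in>paths_from X x0. \<forall>b\<in>loops_at (V a) (pathfinish a).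
       homotopic_paths X b (\<lambda>_. pathfinish a))"
  unfolding path_spanier_subgroup_eq_generate[OF assms]
    group.generate_trivial_iff[OF group_pi1[OF assms(1)]]
  by (subst lasso_classes_trivial_iff) (use path_open_cover_subset[OF assms(2)] in auto)

lemma spanier_discrete_iff_subgroup:
  assumes "x0 \<in> X"
  shows "spanier_topology X x0 = discrete_topology (carrier (pi1 X x0)) \<longleftrightarrow>
    (\<exists>\<U>. open_cover X \<U> \<and> spanier_subgroup X \<U> x0 = {\<one>\<^bsub>pi1 X x0\<^esub>})"
proof -
  have "spanier_topology X x0 = discrete_topology (carrier (pi1 X x0)) \<longleftrightarrow>
      {\<one>\<^bsub>pi1 X x0\<^esub>} \<in> {spanier_subgroup X \<U> x0 | \<U>. open_cover X \<U>}"
    unfolding spanier_topology_def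
  proof (rule coset_topology_discrete_iff[OF group_pi1[OF assms]])
    fix H K
    assume "H \<in> {spanier_subgroup X \<U> x0 | \<U>. open_cover X \<U>}"
      and "K \<in> {spanier_subgroup X \<U> x0 | \<U>. open_cover X \<U>}"
    then obtain \<U> \<W> where "open_cover X \<U>" "open_cover X \<W>"
      and HK: "H = spanier_subgroup X \<U> x0" "K = spanier_subgroup X \<W> x0"
      by blast
    then obtain \<R> where "open_cover X \<R>" "spanier_subgroup X \<R> x0 \<subseteq> H \<inter> K"
      using spanier_subgroups_directed by metis
    then show "\<exists>L\<in>{spanier_subgroup X \<U> x0 | \<U>. open_cover X \<U>}. L \<subseteq> H \<inter> K"
      by blast
  qed (auto intro: subgroup_spanier[OF assms])
  then show ?thesis by blast
qed

lemma path_spanier_discrete_iff_subgroup: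
  assumes "x0 \<in> X"
  shows "path_spanier_topology X x0 = discrete_topology (carrier (pi1 X x0)) \<longleftrightarrow>
    (\<exists>V. path_open_cover X x0 V \<and> path_spanier_subgroup X V x0 = {\<one>\<^bsub>pi1 X x0\<^esub>})"
proof -
  have "path_spanier_topology X x0 = discrete_topology (carrier (pi1 X x0)) \<longleftrightarrow>
      {\<one>\<^bsub>pi1 X x0\<^esub>} \<in> {path_spanier_subgroup X V x0 | V. path_open_cover X x0 V}"
    unfolding path_spanier_topology_def
  proof (rule coset_topology_discrete_iff[OF group_pi1[OF assms]])
    fix H K
    assume "H \<in> {path_spanier_subgroup X V x0 | V. path_open_cover X x0 V}"
      and "K \<in> {path_spanier_subgroup X V x0 | V. path_open_cover X x0 V}"
    then obtain V W where "path_open_cover X x0 V" "path_open_cover X x0 W"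
      and HK: "H = path_spanier_subgroup X V x0" "K = path_spanier_subgroup X W x0"
      by blast
    then obtain R where "path_open_cover X x0 R" "path_spanier_subgroup X R x0 \<subseteq> H \<inter> K"
      using path_spanier_subgroups_directed[OF assms] by metis
    then show "\<exists>L\<in>{path_spanier_subgroup X V x0 | V. path_open_cover X x0 V}. L \<subseteq> H \<inter> K"
      by blast
  qed (auto intro: subgroup_path_spanier[OF assms])
  then show ?thesis by blast
qed

lemma spanier_discrete_iff:
  assumes "x0 \<in> X"
  shows "spanier_topology X x0 = discrete_topology (carrier (pi1 X x0)) \<longleftrightarrow>
    (\<exists>\<U>. open_cover X \<U> \<and>
      (\<forall>a\<in>paths_from X x0. \<forall>U\<in>\<U>. \<forall>b\<in>loops_at U (pathfinish a).
         homotopic_paths X b (\<lambda>_. pathfinish a)))"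
  unfolding spanier_discrete_iff_subgroup[OF assms]
  by (intro ex_cong1 conj_cong refl spanier_subgroup_trivial_iff[OF assms])

lemma path_spanier_discrete_iff:
  assumes "x0 \<in> X"
  shows "path_spanier_topology X x0 = discrete_topology (carrier (pi1 X x0)) \<longleftrightarrow>
    (\<exists>V. path_open_cover X x0 V \<and>
      (\<forall>a\<in>paths_from X x0. \<forall>b\<in>loops_at (V a) (pathfinish a).
         homotopic_paths X b (\<lambda>_. pathfinish a)))"
  unfolding path_spanier_discrete_iff_subgroup[OF assms]
  by (intro ex_cong1 conj_cong refl path_spanier_subgroup_trivial_iff[OF assms])

lemma spanier_group_trivial:
  assumes "x0 \<in> X" "spanier_topology X x0 = discrete_topology (carrier (pi1 X x0))"
  shows "spanier_group X x0 = {\<one>\<^bsub>pi1 X x0\<^esub>}"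
proof -
  obtain \<U> where "open_cover X \<U>" "spanier_subgroup X \<U> x0 = {\<one>\<^bsub>pi1 X x0\<^esub>}"
    using assms spanier_discrete_iff_subgroup by blast
  then have "spanier_group X x0 \<subseteq> {\<one>\<^bsub>pi1 X x0\<^esub>}"
    unfolding spanier_group_def by blast
  moreover have "\<one>\<^bsub>pi1 X x0\<^esub> \<in> spanier_group X x0"
    unfolding spanier_group_def using subgroup.one_closed[OF subgroup_spanier[OF assms(1)]] by blast
  ultimately show ?thesis by blast
qed

lemma path_spanier_group_trivial:
  assumes "x0 \<in> X" "path_spanier_topology X x0 = discrete_topology (carrier (pi1 X x0))"
  shows "path_spanier_group X x0 = {\<one>\<^bsub>pi1 X x0\<^esub>}"
proof -
  obtain V where "path_open_cover X x0 V" "path_spanier_subgroup X V x0 = {\<one>\<^bsub>pi1 X x0\<^esub>}"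
    using assms path_spanier_discrete_iff_subgroup by blast
  then have "path_spanier_group X x0 \<subseteq> {\<one>\<^bsub>pi1 X x0\<^esub>}"
    unfolding path_spanier_group_def by blast
  moreover have "\<one>\<^bsub>pi1 X x0\<^esub> \<in> path_spanier_group X x0"
    unfolding path_spanier_group_def
    using subgroup.one_closed[OF subgroup_path_spanier[OF assms(1)]] by blast
  ultimately show ?thesis by blast
qed

section \<open>Comparison of the conditions on covers\<close>

text \<open>Endpoints of paths from \<open>x0\<close> are points of \<open>X\<close>, so the neighbourhoods on which loops are
  null-homotopic form an open cover as required.\<close>

lemma unbased_slsc_imp_spanier_discrete:
  assumes "x0 \<in> X" "unbased_slsc X"
  shows "spanier_topology X x0 = discrete_topology (carrier (pi1 X x0))"
proof -
  let ?\<U> = "{U. openin (top_of_set X) U \<and>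
    (\<forall>y\<in>U. \<forall>b\<in>loops_at U y. homotopic_paths X b (\<lambda>_. y))}"
  have "open_cover X ?\<U>"
    unfolding open_cover_def
  proof (intro conjI subset_antisym)
    show "\<Union>?\<U> \<subseteq> X" by (auto dest: openin_imp_subset)
    show "X \<subseteq> \<Union>?\<U>" using assms(2) unfolding unbased_slsc_def by blast
  qed blast
  moreover have "\<forall>a\<in>paths_from X x0. \<forall>U\<in>?\<U>. \<forall>b\<in>loops_at U (pathfinish a).
      homotopic_paths X b (\<lambda>_. pathfinish a)"
  proof (intro ballI)
    fix a U b assume U: "U \<in> ?\<U>" and b: "b \<in> loops_at U (pathfinish a)"
    have "pathfinish a \<in> U" using b by (rule base_point_in)
    then show "homotopic_paths X b (\<lambda>_. pathfinish a)" using U b by blast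
  qed
  ultimately show ?thesis
    unfolding spanier_discrete_iff[OF assms(1)] by (intro exI conjI)
qed

lemma spanier_discrete_imp_unbased_slsc:
  assumes "x0 \<in> X" "path_connected X"
    and "spanier_topology X x0 = discrete_topology (carrier (pi1 X x0))"
  shows "unbased_slsc X"
  unfolding unbased_slsc_def
proof
  fix x assume x: "x \<in> X"
  obtain \<U> where \<U>: "open_cover X \<U>"
    and null: "\<forall>a\<in>paths_from X x0. \<forall>U\<in>\<U>. \<forall>b\<in>loops_at U (pathfinish a).
      homotopic_paths X b (\<lambda>_. pathfinish a)"
    using assms(3) unfolding spanier_discrete_iff[OF assms(1)] by blast
  obtain U where U: "U \<in> \<U>" "x \<in> U" "openin (top_of_set X) U"
    using \<U> x unfolding open_cover_def by blast
  have "homotopic_paths X b (\<lambda>_. y)" if "y \<in> U" "b \<in> loops_at U y" for y b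
  proof -
    have "path_component X x0 y"
      using assms(1,2) that(1) open_cover_subset[OF \<U> U(1)] by (auto simp: path_connected_component)
    then obtain a where "a \<in> paths_from X x0" "pathfinish a = y"
      by (rule path_component_imp_paths_from)
    then show ?thesis using null[rule_format, of a U b] U(1) that(2) by simp
  qed
  then show "\<exists>U. openin (top_of_set X) U \<and> x \<in> U \<and>
      (\<forall>y\<in>U. \<forall>b\<in>loops_at U y. homotopic_paths X b (\<lambda>_. y))"
    using U(2,3) by blast
qed

lemma spanier_discrete_imp_path_spanier_discrete:
  assumes "x0 \<in> X" "spanier_topology X x0 = discrete_topology (carrier (pi1 X x0))"
  shows "path_spanier_topology X x0 = discrete_topology (carrier (pi1 X x0))"
proof -
  obtain \<U> where \<U>: "open_cover X \<U>"
    and null: "\<forall>a\<in>paths_from X x0. \<forall>U\<in>\<U>. \<forall>b\<in>loops_at U (pathfinish a).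
      homotopic_paths X b (\<lambda>_. pathfinish a)"
    using assms(2) unfolding spanier_discrete_iff[OF assms(1)] by blast
  have "\<exists>U. U \<in> \<U> \<and> pathfinish a \<in> U" if "a \<in> paths_from X x0" for a
  proof -
    have "pathfinish a \<in> \<Union>\<U>"
      using paths_fromD(4)[OF that] \<U> by (simp add: open_cover_def)
    then show ?thesis by blast
  qed
  then obtain V where V: "\<And>a. a \<in> paths_from X x0 \<Longrightarrow> V a \<in> \<U> \<and> pathfinish a \<in> V a"
    by metis
  then have "path_open_cover X x0 V"
    using \<U> by (simp add: path_open_cover_def open_cover_def)
  moreover have "\<forall>a\<in>paths_from X x0. \<forall>b\<in>loops_at (V a) (pathfinish a).
      homotopic_paths X b (\<lambda>_. pathfinish a)"
    by (intro ballI null[rule_format, OF _ conjunct1[OF V]])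
  ultimately show ?thesis
    unfolding path_spanier_discrete_iff[OF assms(1)] by (intro exI conjI)
qed

text \<open>In a path connected \<open>W \<subseteq> V a\<close> around the endpoint of \<open>a\<close>, a loop with another base point is
  joined to that endpoint by a path \<open>c\<close> in \<open>W\<close>. The conjugate of the loop by \<open>c\<close> lies in \<open>V a\<close>
  and is based at the endpoint, hence null-homotopic, and so is the loop itself. The path component
  of \<open>x0\<close> is closed in a locally path connected space, and its complement completes the cover without
  adding a condition, since no path from \<open>x0\<close> ends there.\<close>

lemma path_open_cover_imp_open_cover:
  assumes lpc: "locally path_connected X" and V: "path_open_cover X x0 V"
    and null: "\<And>a b. \<lbrakk>a \<in> paths_from X x0; b \<in> loops_at (V a) (pathfinish a)\<rbrakk>
      \<Longrightarrow> homotopic_paths X b (\<lambda>_. pathfinish a)"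
  obtains \<U> where "open_cover X \<U>"
    and "\<And>a U b. \<lbrakk>a \<in> paths_from X x0; U \<in> \<U>; b \<in> loops_at U (pathfinish a)\<rbrakk>
      \<Longrightarrow> homotopic_paths X b (\<lambda>_. pathfinish a)"
proof -
  have "\<exists>W. openin (top_of_set X) W \<and> path_connected W \<and> pathfinish a \<in> W \<and> W \<subseteq> V a"
    if "a \<in> paths_from X x0" for a
  proof -
    have "openin (top_of_set X) (V a)" "pathfinish a \<in> V a"
      using V that by (simp_all add: path_open_cover_def)
    then show ?thesis using lpc[unfolded locally_path_connected] by blast
  qed
  then obtain W where W: "\<And>a. a \<in> paths_from X x0 \<Longrightarrow>
      openin (top_of_set X) (W a) \<and> path_connected (W a) \<and> pathfinish a \<in> W a \<and> W a \<subseteq> V a"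
    by metis
  let ?R = "X - path_component_set X x0"
  let ?\<U> = "insert ?R (W ` paths_from X x0)"
  have "openin (top_of_set X) ?R"
    using closedin_path_component_locally_path_connected[OF lpc]
    by (simp add: closedin_def)
  moreover have "path_component_set X x0 \<subseteq> \<Union>(W ` paths_from X x0)"
  proof
    fix y assume "y \<in> path_component_set X x0"
    then obtain a where "a \<in> paths_from X x0" "pathfinish a = y"
      by (auto elim: path_component_imp_paths_from)
    then show "y \<in> \<Union>(W ` paths_from X x0)" using W[of a] by auto
  qed
  moreover have "\<Union>(W ` paths_from X x0) \<subseteq> X"
    using W by (auto dest: openin_imp_subset)
  moreover have "path_component_set X x0 \<subseteq> X"
    by (rule path_component_subset)
  ultimately have "\<Union>?\<U> = X" by auto
  moreover have "openin (top_of_set X) U" if "U \<in> ?\<U>" for U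
    using that W \<open>openin (top_of_set X) ?R\<close> by auto
  ultimately have "open_cover X ?\<U>"
    by (simp add: open_cover_def)
  moreover have "homotopic_paths X b (\<lambda>_. pathfinish e)"
    if e: "e \<in> paths_from X x0" and U: "U \<in> ?\<U>" and b: "b \<in> loops_at U (pathfinish e)" for e U b
  proof -
    have eU: "pathfinish e \<in> U"
      using b by (rule base_point_in)
    then have "U \<noteq> ?R" using paths_from_imp_path_component[OF e] by auto
    then obtain a where a: "a \<in> paths_from X x0" "U = W a" using U by blast
    then obtain c where c: "path c" "path_image c \<subseteq> W a" "pathstart c = pathfinish a"
        "pathfinish c = pathfinish e"
      using W[OF a(1)] eU unfolding path_connected_def by blast
    have WV: "W a \<subseteq> V a" and VX: "V a \<subseteq> X"
      using W[OF a(1)] path_open_cover_subset[OF V a(1)] by auto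
    have b': "b \<in> loops_at (W a) (pathfinish c)" using b a(2) c(4) by simp
    have "c +++ b +++ reversepath c \<in> loops_at (V a) (pathfinish a)"
      using conjugate_in_loops_at[OF c(1,2) b'] loops_at_mono[OF WV] c(3) by auto
    then have "homotopic_paths X (c +++ b +++ reversepath c) (\<lambda>_. pathstart c)"
      using null[OF a(1)] c(3) by simp
    then have "homotopic_paths X b (\<lambda>_. pathfinish c)"
      using homotopic_paths_lasso_iff[of c X b] c(1,2) b' loops_at_mono[of "W a" X] WV VX by blast
    then show ?thesis using c(4) by simp
  qed
  ultimately show thesis by (rule that)
qed

lemma path_spanier_discrete_imp_spanier_discrete:
  assumes "locally path_connected X" "x0 \<in> X"
    and "path_spanier_topology X x0 = discrete_topology (carrier (pi1 X x0))"
  shows "spanier_topology X x0 = discrete_topology (carrier (pi1 X x0))"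
proof -
  obtain V where V: "path_open_cover X x0 V"
    and null: "\<forall>a\<in>paths_from X x0. \<forall>b\<in>loops_at (V a) (pathfinish a).
      homotopic_paths X b (\<lambda>_. pathfinish a)"
    using assms(3) unfolding path_spanier_discrete_iff[OF assms(2)] by blast
  show ?thesis
    unfolding spanier_discrete_iff[OF assms(2)]
  proof (rule path_open_cover_imp_open_cover[OF assms(1) V null[rule_format]])
    fix \<U>
    assume "open_cover X \<U>"
      and "\<And>a U b. \<lbrakk>a \<in> paths_from X x0; U \<in> \<U>; b \<in> loops_at U (pathfinish a)\<rbrakk>
        \<Longrightarrow> homotopic_paths X b (\<lambda>_. pathfinish a)"
    then show "\<exists>\<U>. open_cover X \<U> \<and>
        (\<forall>a\<in>paths_from X x0. \<forall>U\<in>\<U>. \<forall>b\<in>loops_at U (pathfinish a).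
           homotopic_paths X b (\<lambda>_. pathfinish a))"
      by (intro exI conjI ballI)
  qed
qed

theorem corollary3p8:
  fixes X :: "'a::topological_space set" and x0 :: 'a
  assumes "locally path_connected X" and "x0 \<in> X"
  shows "(path_connected X \<longrightarrow>
      (unbased_slsc X \<longleftrightarrow> spanier_topology X x0 = discrete_topology (carrier (pi1 X x0))) \<and>
      (spanier_topology X x0 = discrete_topology (carrier (pi1 X x0)) \<longleftrightarrow>
        path_spanier_topology X x0 = discrete_topology (carrier (pi1 X x0)))) \<and>
    (unbased_slsc X \<longrightarrow> spanier_topology X x0 = discrete_topology (carrier (pi1 X x0))) \<and>
    (spanier_topology X x0 = discrete_topology (carrier (pi1 X x0)) \<longleftrightarrow>
      path_spanier_topology X x0 = discrete_topology (carrier (pi1 X x0))) \<and>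
    (unbased_slsc X \<or>
      spanier_topology X x0 = discrete_topology (carrier (pi1 X x0)) \<or>
      path_spanier_topology X x0 = discrete_topology (carrier (pi1 X x0)) \<longrightarrow>
      spanier_topology X x0 = path_spanier_topology X x0 \<and>
      path_spanier_group X x0 = spanier_group X x0)"
proof -
  let ?S = "spanier_topology X x0 = discrete_topology (carrier (pi1 X x0))"
  let ?P = "path_spanier_topology X x0 = discrete_topology (carrier (pi1 X x0))"
  have slsc: "unbased_slsc X \<Longrightarrow> ?S"
    by (rule unbased_slsc_imp_spanier_discrete[OF assms(2)])
  have pc: "unbased_slsc X" if "path_connected X" ?S
    using spanier_discrete_imp_unbased_slsc[OF assms(2)] that by blast
  have eq: "?S \<longleftrightarrow> ?P"
    using spanier_discrete_imp_path_spanier_discrete[OF assms(2)]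
      path_spanier_discrete_imp_spanier_discrete[OF assms] by blast
  have "spanier_topology X x0 = path_spanier_topology X x0 \<and>
      path_spanier_group X x0 = spanier_group X x0" if ?S
  proof -
    have ?P using that eq by blast
    then show ?thesis
      using that spanier_group_trivial[OF assms(2)] path_spanier_group_trivial[OF assms(2)] by simp
  qed
  then show ?thesis using slsc pc eq by blast
qed

end
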